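(* Let $U\subset\mathbb C$ be an open neighborhood of $0$, let $s:U\to\mathbb C$ be a continuous function with $s(0)=1$, and let $\alpha:U\to\mathbb R$ be a real-valued function such that $$\overline{s(\varepsilon)}\,(1+\varepsilon)\,s(\varepsilon)=1+\alpha(\varepsilon)i\qquad\text{for all }\varepsilon\in U .$$ Put $\varphi(\varepsilon):=1+\alpha(\varepsilon)i$ for $\varepsilon\in U$. Then the function $s$ is not holomorphic at $0$, and the function $\varphi$ is not holomorphic at $0$.
   Context: A complex-valued function defined near $0\in\mathbb C$ is holomorphic at $0$ if it is complex differentiable at every point of some neighborhood of $0$. Two complex square matrices $A,B$ are *congruent if $A=S^*BS$ for some nonsingular complex $S$, where $S^*$ is the conjugate transpose; for $1\times 1$ matrices $[s]^*=[\overline{s}]$. The displayed identity says that the $1\times1$ matrices $[1+\varepsilon]$ near $[1]$ are simultaneously reduced by the *congruence transformations $[s(\varepsilon)]^*[1+\varepsilon][s(\varepsilon)]$ to the form $[1+\alpha(\varepsilon)i]$ with $\alpha(\varepsilon)$ real, which is the miniversal deformation of the $1\times 1$ matrix $[1]$ under *congruence. *)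

theory Defs
  imports "HOL-Complex_Analysis.Complex_Analysis"
begin

end

theory Submission
  imports Defs
begin

text \<open>Taking real parts gives \<open>|s|\<^sup>2 (1 + Re \<epsilon>) = 1\<close>, hence \<open>\<phi> (1 + Re \<epsilon>) = 1 + \<epsilon>\<close>.
  Differentiating the latter at \<open>0\<close> along \<open>1\<close> and along \<open>\<i>\<close> gives
  \<open>\<phi>'(0) = 0\<close> and \<open>\<phi>'(0) = 1\<close>. Differentiating the former shows that a holomorphic \<open>s\<close> satisfies
  \<open>2 (1 + Re \<epsilon>) s' = - s\<close> near \<open>0\<close>; in particular \<open>s'(0) = - 1/2\<close>, whereas differentiating this
  relation once more along \<open>1\<close> and along \<open>\<i>\<close> forces \<open>s'(0) = 0\<close>.\<close>

text \<open>Serves to compare two sides of an identity in every real direction. The real-linear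
  \<open>has_derivative\<close> is needed because \<open>Re\<close> and \<open>cnj\<close> have no
  complex derivative.\<close>

lemma has_derivative_eq_if_eq_on_open:
  assumes "(f has_derivative f') (at x)" "(g has_derivative g') (at x)"
    and "open S" "x \<in> S" "\<And>y. y \<in> S \<Longrightarrow> f y = g y"
  shows "f' = g'"
proof -
  have "(g has_derivative f') (at x)"
    using has_derivative_transform_within_open[OF assms(1,3,4)] assms(5) by blast
  then show ?thesis
    using assms(2) has_derivative_unique by blast
qed

lemma not_analytic_if_mult_one_plus_Re:
  assumes "open U" "0 \<in> U"
    and eq: "\<And>z. z \<in> U \<Longrightarrow> f z * (1 + complex_of_real (Re z)) = 1 + z"
  shows "\<not> f analytic_on {0}"
proof
  assume "f analytic_on {0}"
  then obtain D where D: "(f has_field_derivative D) (at 0)"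
    using analytic_on_imp_differentiable_at field_differentiable_def by blast
  \<comment> \<open>This value is the coefficient of \<open>Re h\<close> in the product rule at
    \<open>0\<close>.\<close>
  have f0: "f 0 = 1" using eq[OF assms(2)] by simp
  have 1: "((\<lambda>z. f z * (1 + complex_of_real (Re z))) has_derivative
      (\<lambda>h. D * h + complex_of_real (Re h))) (at 0)"
    using D[THEN has_field_derivative_imp_has_derivative]
    by (auto intro!: derivative_eq_intros simp: f0)
  have 2: "((\<lambda>z. 1 + z) has_derivative (\<lambda>h. h)) (at (0::complex))"
    by (auto intro!: derivative_eq_intros)
  have e: "(\<lambda>h. D * h + complex_of_real (Re h)) = (\<lambda>h. h)"
    using has_derivative_eq_if_eq_on_open[OF 1 2 assms(1,2)] eq by blast
  show False
    using fun_cong[OF e, of 1] fun_cong[OF e, of \<i>] by simp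
qed

text \<open>The derivative of the constant left-hand side vanishes in every direction. Direction
  \<open>\<i>\<close> shows that \<open>cnj (s z) * D\<close> is real, so in direction
  \<open>1\<close> the two conjugate terms coincide and \<open>cnj (s z)\<close> cancels.\<close>

lemma deriv_of_norm_square_mult_one_plus_Re:
  assumes "open U" "z \<in> U" and D: "(s has_field_derivative D) (at z)"
    and eq: "\<And>w. w \<in> U \<Longrightarrow> cnj (s w) * s w * (1 + complex_of_real (Re w)) = 1"
  shows "D * (2 * (1 + complex_of_real (Re z))) = - s z"
proof -
  let ?r = "1 + complex_of_real (Re z)"
  have 1: "((\<lambda>w. cnj (s w) * s w * (1 + complex_of_real (Re w))) has_derivative
      (\<lambda>h. (cnj (s z) * (D * h) + cnj (D * h) * s z) * ?r
           + cnj (s z) * s z * complex_of_real (Re h))) (at z)"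
    using D[THEN has_field_derivative_imp_has_derivative]
    by (auto intro!: derivative_eq_intros simp: algebra_simps)
  have 2: "((\<lambda>w. 1) has_derivative (\<lambda>h. 0)) (at z)"
    by simp
  have e: "(\<lambda>h. (cnj (s z) * (D * h) + cnj (D * h) * s z) * ?r
           + cnj (s z) * s z * complex_of_real (Re h)) = (\<lambda>h. 0)"
    using has_derivative_eq_if_eq_on_open[OF 1 2 assms(1,2)] eq by blast
  have nz: "?r \<noteq> 0" "cnj (s z) \<noteq> 0"
    using eq[OF assms(2)] by auto
  have e1: "(cnj (s z) * D + cnj D * s z) * ?r + cnj (s z) * s z = 0"
    using fun_cong[OF e, of 1] by simp
  \<comment> \<open>As \<open>Re \<i> = 0\<close>, the last summand disappears, and
    \<open>cnj (D * \<i>) = - \<i> * cnj D\<close> produces the difference.\<close>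
  have "\<i> * (cnj (s z) * D - cnj D * s z) * ?r = 0"
    using fun_cong[OF e, of \<i>] by (simp add: algebra_simps)
  then have "cnj D * s z = cnj (s z) * D"
    using nz by simp
  then have "cnj (s z) * (D * (2 * ?r) + s z) = 0"
    using e1 by (simp add: algebra_simps)
  then show ?thesis
    using nz by (simp add: add_eq_0_iff)
qed

lemma not_analytic_if_norm_square_mult_one_plus_Re:
  assumes "open U" "0 \<in> U" "s 0 \<noteq> 0"
    and eq: "\<And>z. z \<in> U \<Longrightarrow> cnj (s z) * s z * (1 + complex_of_real (Re z)) = 1"
  shows "\<not> s analytic_on {0}"
proof
  assume "s analytic_on {0}"
  then obtain S where S: "open S" "0 \<in> S" "s holomorphic_on S"
    by (auto simp: analytic_at)
  define V where "V = S \<inter> U"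
  have V: "open V" "0 \<in> V" "s holomorphic_on V"
    using S assms(1,2) by (auto simp: V_def intro: holomorphic_on_subset)
  have ode: "deriv s z * (2 * (1 + complex_of_real (Re z))) = - s z" if "z \<in> V" for z
    using deriv_of_norm_square_mult_one_plus_Re[OF V(1) that holomorphic_derivI[OF V(3,1) that]] eq
    by (auto simp: V_def)
  have s: "(s has_field_derivative deriv s 0) (at 0)"
    using holomorphic_derivI[OF V(3,1,2)] .
  \<comment> \<open>\<open>E\<close> is the second derivative of \<open>s\<close> at
    \<open>0\<close>; it exists since \<open>deriv s\<close> is again holomorphic on
    \<open>V\<close>.\<close>
  obtain E where E: "(deriv s has_field_derivative E) (at 0)"
    using holomorphic_derivI[OF holomorphic_deriv[OF V(3,1)] V(1,2)] by blast
  have 1: "((\<lambda>z. deriv s z * (2 * (1 + complex_of_real (Re z)))) has_derivative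
      (\<lambda>h. E * h * 2 + deriv s 0 * (2 * complex_of_real (Re h)))) (at 0)"
    using E[THEN has_field_derivative_imp_has_derivative]
    by (auto intro!: derivative_eq_intros)
  have 2: "((\<lambda>z. - s z) has_derivative (\<lambda>h. - (deriv s 0 * h))) (at 0)"
    using s[THEN has_field_derivative_imp_has_derivative]
    by (auto intro!: derivative_eq_intros)
  have e: "(\<lambda>h. E * h * 2 + deriv s 0 * (2 * complex_of_real (Re h)))
      = (\<lambda>h. - (deriv s 0 * h))"
    using has_derivative_eq_if_eq_on_open[OF 1 2 V(1,2)] ode by blast
  have "\<i> * (E * 2 + deriv s 0) = 0"
    using fun_cong[OF e, of \<i>] by (simp add: algebra_simps)
  then have "E * 2 = - deriv s 0"
    by (simp add: add_eq_0_iff2)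
  \<comment> \<open>Direction \<open>1\<close> reads
    \<open>2 * E + 2 * deriv s 0 = - deriv s 0\<close>; inserting the value of \<open>E * 2\<close>
    leaves \<open>2 * deriv s 0 = 0\<close>.\<close>
  then have "deriv s 0 = 0"
    using fun_cong[OF e, of 1] by simp
  then show False
    using ode[OF V(2)] assms(3) by simp
qed

theorem mainTheorem1:
  fixes U :: "complex set" and s \<phi> :: "complex \<Rightarrow> complex" and \<alpha> :: "complex \<Rightarrow> real"
  assumes "open U" and "0 \<in> U"
    and "continuous_on U s" and "s 0 = 1"
    and "\<And>\<epsilon>. \<epsilon> \<in> U \<Longrightarrow>
           cnj (s \<epsilon>) * (1 + \<epsilon>) * s \<epsilon> = 1 + complex_of_real (\<alpha> \<epsilon>) * \<i>"
    and "\<And>\<epsilon>. \<epsilon> \<in> U \<Longrightarrow> \<phi> \<epsilon> = 1 + complex_of_real (\<alpha> \<epsilon>) * \<i>"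
  shows "\<not> s analytic_on {0} \<and> \<not> \<phi> analytic_on {0}"
proof
  have norm_eq: "cnj (s z) * s z * (1 + complex_of_real (Re z)) = 1" if "z \<in> U" for z
  proof -
    have "complex_of_real ((cmod (s z))\<^sup>2) * (1 + z) = 1 + complex_of_real (\<alpha> z) * \<i>"
      using assms(5)[OF that] by (simp only: complex_norm_square mult_ac)
    from arg_cong[OF this, of Re] have "(cmod (s z))\<^sup>2 * (1 + Re z) = 1"
      by (simp flip: of_real_power)
    then have "complex_of_real ((cmod (s z))\<^sup>2) * (1 + complex_of_real (Re z)) = 1"
      by (metis of_real_1 of_real_add of_real_mult)
    then show ?thesis
      by (simp only: complex_norm_square mult_ac)
  qed
  then show "\<not> s analytic_on {0}"
    using not_analytic_if_norm_square_mult_one_plus_Re assms(1,2,4) by simp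
  \<comment> \<open>Here \<open>\<alpha>\<close> is eliminated: \<open>\<phi> z\<close> equals
    \<open>cnj (s z) * s z * (1 + z)\<close>, and by \<open>norm_eq\<close> the factor
    \<open>1 + Re z\<close> is inverse to \<open>cnj (s z) * s z\<close>.\<close>
  have "\<phi> z * (1 + complex_of_real (Re z)) = 1 + z" if "z \<in> U" for z
  proof -
    have "\<phi> z * (1 + complex_of_real (Re z))
        = (cnj (s z) * s z * (1 + complex_of_real (Re z))) * (1 + z)"
      unfolding assms(6)[OF that] assms(5)[OF that, symmetric] by (simp only: mult_ac)
    then show ?thesis
      using norm_eq[OF that] by simp
  qed
  then show "\<not> \<phi> analytic_on {0}"
    using not_analytic_if_mult_one_plus_Re assms(1,2) by blast
qed

end
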